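(* $\mathcal{A}\mathrm{Sp}(A_\infty)=Dend_\infty$; that is, under the identification $\binom{\omega_n}{e_i}=\omega_{n,i}$ ($n\ge1$, $1\le i\le n$) of generators, the arity-splitting of the nonsymmetric graded operad $A_\infty$ (with its presentation recalled in the context) is the operad $Dend_\infty$.
   Context: All operads are nonsymmetric graded operads over a field $\mathbf{k}$, given by generators and relations; $[n]=\{1,\dots,n\}$. $A_\infty$: generators $\omega_n$ of arity $n$ (degree $n-2$), $n\ge1$; relations $\omega_1\circ\omega_1=0$ and, for $n\ge2$, $$\partial(\omega_n)=\sum(-1)^{p+qr}\,\omega_k\circ(\mathrm{id}^{\otimes p}\otimes\omega_q\otimes\mathrm{id}^{\otimes r}),$$ the sum over $p,r\ge0$, $q>1$ with $n=p+q+r$, $k=p+1+r>1$, where $\partial(\omega_n):=\omega_1\circ\omega_n-(-1)^{n-2}\omega_n\circ\big((\omega_1,\mathrm{id},\dots,\mathrm{id})+\cdots+(\mathrm{id},\dots,\mathrm{id},\omega_1)\big)$. $Dend_\infty$: generators $\omega_{n,i}$ of arity $n$ (degree $n-2$), $n\ge1$, $1\le i\le n$; relations $\omega_{1,1}\circ\omega_{1,1}=0$ and, for $n\ge2$, $1\le i\le n$, $$\partial(\omega_{n,i})=\sum(-1)^{p+qr}\,\omega_{p+1+r,\ell}\circ(\mathrm{id}^{\otimes p}\otimes\omega_{q,j}\otimes\mathrm{id}^{\otimes r}),$$ where $\partial(\omega_{n,i}):=\omega_{1,1}\circ\omega_{n,i}-(-1)^{n-2}\omega_{n,i}\circ\big((\omega_{1,1},\mathrm{id},\dots,\mathrm{id})+\cdots+(\mathrm{id},\dots,\mathrm{id},\omega_{1,1})\big)$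 and the sum is over all $(p,q,r,\ell,j)$ with $p\ge0$, $q\ge2$, $r\ge0$, $p+q+r=n$, $p+1+r\ge2$, $1\le\ell\le p+1+r$, $1\le j\le q$ such that $i=q+\ell-1$ if $p+1\le\ell-1$; $i=\ell-1+j$ if $p+1=\ell$; $i=\ell$ if $\ell+1\le p+1$. Arity-splitting. For a nonsymmetric operad $\mathcal{P}=\mathcal{T}_{ns}(V)/(R)$ with $\mathcal{V}=\coprod_n\mathcal{V}_n$ a basis of the generators and $R=\{r_s=\sum_ic_{s,i}\tau_{s,i}\}$, $\tau_{s,i}$ planar trees with vertices decorated by $\mathcal{V}$ (according to arity) and, for fixed $s$, all with the same number $n_s$ of leaves numbered $1,\dots,n_s$ left to right: put $\mathcal{A}\mathrm{Sp}(V)_n=V_n\otimes\bigoplus_{i=1}^n\mathbf{k}e_i$, $\binom{\omega}{e_i}=\omega\otimes e_i$, $\binom{\omega}{*}=\sum_{i=1}^n\binom{\omega}{e_i}$. For a decorated tree $\tau$, $\mathcal{A}\mathrm{Sp}(\tau)$ is $\tau$ with each vertex $\omega$ replaced by $\binom{\omega}{*}$ (expanded multilinearly); for a leaf $x$ of $\tau$, $\mathcal{A}\mathrm{Sp}_x(|)=|$ for the trivial tree and, if $\tau=\omega(\tau_1\vee\cdots\vee\tau_\ell)$ (grafting of $\tau_1,\dots,\tau_\ell$ on a root vertex $\omega$) with $x$ a leaf of $\tau_i$, $\mathcal{A}\mathrm{Sp}_x(\tau)=\binom{\omega}{e_i}(\mathcal{A}\mathrm{Sp}(\tau_1)\vee\cdots\vee\mathcal{A}\mathrm{Sp}_x(\tau_i)\vee\cdots\vee\mathcal{A}\mathrm{Sp}(\tau_\ell))$.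 Then $\mathcal{A}\mathrm{Sp}(\mathcal{P})=\mathcal{T}_{ns}(\mathcal{A}\mathrm{Sp}(V))/(\sum_ic_{s,i}\mathcal{A}\mathrm{Sp}_x(\tau_{s,i}):\ s,\ x\in[n_s])$. *)

theory Defs
  imports Complex_Main "HOL-Library.Poly_Mapping"
begin

section \<open>Planar trees and linear combinations of planar trees\<close>

text \<open>
  The tree \<open>Node v [t1, \<dots>, tl]\<close> stands for the composite
  \<open>v \<circ> (t1 \<otimes> \<dots> \<otimes> tl)\<close> and \<open>Leaf\<close> for the identity.  In particular the
  vertices of a tree, read from left to right in this expression (root first, then the
  subtrees from left to right), come in a definite order; the Koszul signs below are relative to it.
\<close>

datatype 'v tree = Leaf | Node 'v "'v tree list"

record 'v signature =
  gens :: "'v set"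
  arity :: "'v \<Rightarrow> nat"
  deg :: "'v \<Rightarrow> int"

fun leaves :: "'v tree \<Rightarrow> nat" where
  "leaves Leaf = 1"
| "leaves (Node v ts) = sum_list (map leaves ts)"

fun tdeg :: "('v \<Rightarrow> int) \<Rightarrow> 'v tree \<Rightarrow> int" where
  "tdeg d Leaf = 0"
| "tdeg d (Node v ts) = d v + sum_list (map (tdeg d) ts)"

fun wf_tree :: "('v, 'x) signature_scheme \<Rightarrow> 'v tree \<Rightarrow> bool" where
  "wf_tree S Leaf \<longleftrightarrow> True"
| "wf_tree S (Node v ts) \<longleftrightarrow> v \<in> gens S \<and> length ts = arity S v \<and> (\<forall>t\<in>set ts. wf_tree S t)"

type_synonym ('v, 'k) lincomb = "'v tree \<Rightarrow>\<^sub>0 'k"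

definition mon :: "'v tree \<Rightarrow> ('v, 'k::field) lincomb" where
  "mon t = Poly_Mapping.single t 1"

definition scale :: "'k::field \<Rightarrow> ('v, 'k) lincomb \<Rightarrow> ('v, 'k) lincomb" where
  "scale c p = Poly_Mapping.map (\<lambda>x. c * x) p"

definition lin_ext :: "('v tree \<Rightarrow> ('w, 'k) lincomb) \<Rightarrow> ('v, 'k::field) lincomb \<Rightarrow> ('w, 'k) lincomb" where
  "lin_ext f p = (\<Sum>t\<in>Poly_Mapping.keys p. scale (Poly_Mapping.lookup p t) (f t))"

text \<open>The multilinear extension of \<open>\<lambda>[t1, \<dots>, tl]. Node v [t1, \<dots>, tl]\<close>.\<close>

definition mnode :: "'v \<Rightarrow> ('v, 'k::field) lincomb list \<Rightarrow> ('v, 'k) lincomb" where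
  "mnode v ps =
    (\<Sum>ts\<in>listset (map Poly_Mapping.keys ps).
       scale (prod_list (map2 Poly_Mapping.lookup ps ts)) (mon (Node v ts)))"


section \<open>The free graded nonsymmetric operad\<close>

text \<open>Grafting of \<open>u\<close> onto leaf number \<open>i\<close>; leaves are numbered from 1, left to right.\<close>

fun graft_at :: "nat \<Rightarrow> 'v tree \<Rightarrow> 'v tree \<Rightarrow> 'v tree"
  and graft_at_list :: "nat \<Rightarrow> 'v tree list \<Rightarrow> 'v tree \<Rightarrow> 'v tree list" where
  "graft_at i Leaf u = u"
| "graft_at i (Node v ts) u = Node v (graft_at_list i ts u)"
| "graft_at_list i [] u = []"
| "graft_at_list i (t # ts) u =
     (if i \<le> leaves t then graft_at i t u # ts
      else t # graft_at_list (i - leaves t) ts u)"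

text \<open>Total degree of the vertices that come after leaf \<open>i\<close> in the order of vertices.\<close>

fun deg_after :: "('v \<Rightarrow> int) \<Rightarrow> nat \<Rightarrow> 'v tree \<Rightarrow> int"
  and deg_after_list :: "('v \<Rightarrow> int) \<Rightarrow> nat \<Rightarrow> 'v tree list \<Rightarrow> int" where
  "deg_after d i Leaf = 0"
| "deg_after d i (Node v ts) = deg_after_list d i ts"
| "deg_after_list d i [] = 0"
| "deg_after_list d i (t # ts) =
     (if i \<le> leaves t then deg_after d i t + sum_list (map (tdeg d) ts)
      else deg_after_list d (i - leaves t) ts)"

text \<open>
  Partial composition \<open>s \<circ>\<^sub>i t = s \<circ> (id \<otimes> \<dots> \<otimes> t \<otimes> \<dots> \<otimes> id)\<close>: moving \<open>t\<close> to its place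
  among the vertices of \<open>s\<close> passes exactly the vertices of \<open>s\<close> after leaf \<open>i\<close>.  This
  convention yields \<open>(a \<circ>\<^sub>i b) \<circ>\<^sub>i\<^sub>-\<^sub>1\<^sub>+\<^sub>j c = a \<circ>\<^sub>i (b \<circ>\<^sub>j c)\<close> and, for \<open>i < k\<close> and \<open>b\<close> of arity \<open>m\<close>,
  \<open>(a \<circ>\<^sub>i b) \<circ>\<^sub>k\<^sub>-\<^sub>1\<^sub>+\<^sub>m c = (-1)^(\<bar>b\<bar>\<bar>c\<bar>) (a \<circ>\<^sub>k c) \<circ>\<^sub>i b\<close>.
\<close>

definition tree_comp :: "('v \<Rightarrow> int) \<Rightarrow> nat \<Rightarrow> 'v tree \<Rightarrow> 'v tree \<Rightarrow> ('v, 'k::field) lincomb" where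
  "tree_comp d i s t =
     scale (if even (tdeg d t * deg_after d i s) then 1 else - 1) (mon (graft_at i s t))"

definition free_comp ::
  "('v \<Rightarrow> int) \<Rightarrow> nat \<Rightarrow> ('v, 'k::field) lincomb \<Rightarrow> ('v, 'k) lincomb \<Rightarrow> ('v, 'k) lincomb" where
  "free_comp d i p q = lin_ext (\<lambda>s. lin_ext (\<lambda>t. tree_comp d i s t) q) p"

definition free_space :: "('v, 'x) signature_scheme \<Rightarrow> nat \<Rightarrow> ('v, 'k::field) lincomb set" where
  "free_space S n = {p. \<forall>t\<in>Poly_Mapping.keys p. wf_tree S t \<and> leaves t = n}"

definition free_homog :: "('v, 'x) signature_scheme \<Rightarrow> nat \<Rightarrow> int \<Rightarrow> ('v, 'k::field) lincomb set" where
  "free_homog S n e = {p \<in> free_space S n. \<forall>t\<in>Poly_Mapping.keys p. tdeg (deg S) t = e}"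


section \<open>Graded nonsymmetric operads and their presentations\<close>

text \<open>
  \<open>op_space P n\<close> is the space of operations of arity \<open>n\<close>, with homogeneous components
  \<open>op_homog P n e\<close>; \<open>op_comp P m n i a b\<close> is \<open>a \<circ>\<^sub>i b\<close> for \<open>a\<close> of arity \<open>m\<close> and \<open>b\<close> of arity \<open>n\<close>.
  The record holds the operations only; the operads below are all quotients of free operads,
  which is where the operad axioms come from.
\<close>

record ('k, 'a) ns_operad =
  op_space :: "nat \<Rightarrow> 'a set"
  op_homog :: "nat \<Rightarrow> int \<Rightarrow> 'a set"
  op_zero :: "nat \<Rightarrow> 'a"
  op_add :: "nat \<Rightarrow> 'a \<Rightarrow> 'a \<Rightarrow> 'a"
  op_scale :: "nat \<Rightarrow> 'k \<Rightarrow> 'a \<Rightarrow> 'a"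
  op_id :: "'a"
  op_comp :: "nat \<Rightarrow> nat \<Rightarrow> nat \<Rightarrow> 'a \<Rightarrow> 'a \<Rightarrow> 'a"

definition operad_iso :: "('k, 'a) ns_operad \<Rightarrow> ('k, 'b) ns_operad \<Rightarrow> (nat \<Rightarrow> 'a \<Rightarrow> 'b) \<Rightarrow> bool" where
  "operad_iso P Q \<Phi> \<longleftrightarrow>
     (\<forall>n. bij_betw (\<Phi> n) (op_space P n) (op_space Q n)) \<and>
     (\<forall>n e. \<Phi> n ` op_homog P n e = op_homog Q n e) \<and>
     (\<forall>n. \<Phi> n (op_zero P n) = op_zero Q n) \<and>
     (\<forall>n. \<forall>a\<in>op_space P n. \<forall>b\<in>op_space P n.
        \<Phi> n (op_add P n a b) = op_add Q n (\<Phi> n a) (\<Phi> n b)) \<and>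
     (\<forall>n c. \<forall>a\<in>op_space P n. \<Phi> n (op_scale P n c a) = op_scale Q n c (\<Phi> n a)) \<and>
     \<Phi> 1 (op_id P) = op_id Q \<and>
     (\<forall>m n. \<forall>i\<in>{1..m}. \<forall>a\<in>op_space P m. \<forall>b\<in>op_space P n.
        \<Phi> (m + n - 1) (op_comp P m n i a b) = op_comp Q m n i (\<Phi> m a) (\<Phi> n b))"

text \<open>\<open>rels \<P> n\<close> is the set of those defining relators whose trees have \<open>n\<close> leaves.\<close>

record (overloaded) ('v, 'k::zero) presentation = "'v signature" +
  rels :: "nat \<Rightarrow> ('v, 'k) lincomb set"

text \<open>The operadic ideal generated by the relators; \<open>ideal \<P> n\<close> is its part of arity \<open>n\<close>.\<close>

inductive_set ideal_pairs :: "('v, 'k::field) presentation \<Rightarrow> (nat \<times> ('v, 'k) lincomb) set"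
  for \<P> :: "('v, 'k) presentation" where
  zero: "(n, 0) \<in> ideal_pairs \<P>"
| rel: "r \<in> rels \<P> n \<Longrightarrow> (n, r) \<in> ideal_pairs \<P>"
| add: "(n, p) \<in> ideal_pairs \<P> \<Longrightarrow> (n, q) \<in> ideal_pairs \<P> \<Longrightarrow> (n, p + q) \<in> ideal_pairs \<P>"
| scale: "(n, p) \<in> ideal_pairs \<P> \<Longrightarrow> (n, scale c p) \<in> ideal_pairs \<P>"
| comp_left: "(m, p) \<in> ideal_pairs \<P> \<Longrightarrow> q \<in> free_space \<P> n \<Longrightarrow> i \<in> {1..m} \<Longrightarrow>
    (m + n - 1, free_comp (deg \<P>) i p q) \<in> ideal_pairs \<P>"
| comp_right: "p \<in> free_space \<P> m \<Longrightarrow> (n, q) \<in> ideal_pairs \<P> \<Longrightarrow> i \<in> {1..m} \<Longrightarrow>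
    (m + n - 1, free_comp (deg \<P>) i p q) \<in> ideal_pairs \<P>"

definition ideal :: "('v, 'k::field) presentation \<Rightarrow> nat \<Rightarrow> ('v, 'k) lincomb set" where
  "ideal \<P> n = {p. (n, p) \<in> ideal_pairs \<P>}"

definition coset :: "('v, 'k::field) presentation \<Rightarrow> nat \<Rightarrow> ('v, 'k) lincomb \<Rightarrow> ('v, 'k) lincomb set" where
  "coset \<P> n p = {p + z | z. z \<in> ideal \<P> n}"

text \<open>The quotient of the free operad on the generators by the ideal generated by the relators.\<close>

definition presented_operad ::
  "('v, 'k::field) presentation \<Rightarrow> ('k, ('v, 'k) lincomb set) ns_operad" where
  "presented_operad \<P> =
    \<lparr> op_space = (\<lambda>n. coset \<P> n ` free_space \<P> n),
      op_homog = (\<lambda>n e. coset \<P> n ` free_homog \<P> n e),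
      op_zero = (\<lambda>n. coset \<P> n 0),
      op_add = (\<lambda>n A B. \<Union>a\<in>A. \<Union>b\<in>B. coset \<P> n (a + b)),
      op_scale = (\<lambda>n c A. \<Union>a\<in>A. coset \<P> n (scale c a)),
      op_id = coset \<P> 1 (mon Leaf),
      op_comp = (\<lambda>m n i A B. \<Union>a\<in>A. \<Union>b\<in>B. coset \<P> (m + n - 1) (free_comp (deg \<P>) i a b)) \<rparr>"

definition corolla :: "('v, 'x) signature_scheme \<Rightarrow> 'v \<Rightarrow> 'v tree" where
  "corolla S v = Node v (replicate (arity S v) Leaf)"

definition gen_class :: "('v, 'k::field) presentation \<Rightarrow> 'v \<Rightarrow> ('v, 'k) lincomb set" where
  "gen_class \<P> v = coset \<P> (arity \<P> v) (mon (corolla \<P> v))"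


section \<open>Arity-splitting\<close>

text \<open>
  The pair \<open>(v, i)\<close> is the basis element \<open>v \<otimes> e\<^sub>i\<close>.  Replacing \<open>v\<close> by the sum of all
  \<open>(v, i)\<close> and expanding multilinearly produces no signs, since \<open>(v, i)\<close> has the degree of \<open>v\<close>.
\<close>

fun ASp_tree :: "('v \<Rightarrow> nat) \<Rightarrow> 'v tree \<Rightarrow> ('v \<times> nat, 'k::field) lincomb" where
  "ASp_tree ar Leaf = mon Leaf"
| "ASp_tree ar (Node v ts) = (\<Sum>i\<in>{1..ar v}. mnode (v, i) (map (ASp_tree ar) ts))"

text \<open>The index of the tree in the list that contains leaf number \<open>x\<close>, counting from 1.\<close>

fun branch :: "nat \<Rightarrow> 'v tree list \<Rightarrow> nat" where
  "branch x [] = 1"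
| "branch x (t # ts) = (if x \<le> leaves t then 1 else Suc (branch (x - leaves t) ts))"

text \<open>
  \<open>ASp_leaf_list\<close> applies \<open>ASp_leaf\<close> to the tree that contains leaf \<open>x\<close> and
  \<open>ASp_tree\<close> to all other trees.
\<close>

fun ASp_leaf :: "('v \<Rightarrow> nat) \<Rightarrow> nat \<Rightarrow> 'v tree \<Rightarrow> ('v \<times> nat, 'k::field) lincomb"
  and ASp_leaf_list :: "('v \<Rightarrow> nat) \<Rightarrow> nat \<Rightarrow> 'v tree list \<Rightarrow> ('v \<times> nat, 'k::field) lincomb list" where
  "ASp_leaf ar x Leaf = mon Leaf"
| "ASp_leaf ar x (Node v ts) = mnode (v, branch x ts) (ASp_leaf_list ar x ts)"
| "ASp_leaf_list ar x [] = []"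
| "ASp_leaf_list ar x (t # ts) =
     (if x \<le> leaves t then ASp_leaf ar x t # map (ASp_tree ar) ts
      else ASp_tree ar t # ASp_leaf_list ar (x - leaves t) ts)"

definition ASp_presentation :: "('v, 'k::field) presentation \<Rightarrow> ('v \<times> nat, 'k) presentation" where
  "ASp_presentation \<P> =
    \<lparr> gens = {(v, i). v \<in> gens \<P> \<and> i \<in> {1..arity \<P> v}},
      arity = (\<lambda>(v, i). arity \<P> v),
      deg = (\<lambda>(v, i). deg \<P> v),
      rels = (\<lambda>n. {lin_ext (ASp_leaf (arity \<P>) x) r | x r. x \<in> {1..n} \<and> r \<in> rels \<P> n}) \<rparr>"

definition ASp :: "('v, 'k::field) presentation \<Rightarrow> ('k, ('v \<times> nat, 'k) lincomb set) ns_operad" where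
  "ASp \<P> = presented_operad (ASp_presentation \<P>)"


section \<open>The operads A-infinity and Dend-infinity\<close>

text \<open>\<open>a \<circ> (id\<^sup>p \<otimes> b \<otimes> id\<^sup>r)\<close> for generators \<open>a\<close> of arity \<open>p + 1 + r\<close> and \<open>b\<close> of arity \<open>q\<close>.\<close>

definition two_vertex :: "'v \<Rightarrow> nat \<Rightarrow> 'v \<Rightarrow> nat \<Rightarrow> nat \<Rightarrow> ('v, 'k::field) lincomb" where
  "two_vertex a p b q r =
     mon (Node a (replicate p Leaf @ [Node b (replicate q Leaf)] @ replicate r Leaf))"

datatype ainf_gen = Omega nat

definition ainf_boundary :: "nat \<Rightarrow> (ainf_gen, 'k::field) lincomb" where
  "ainf_boundary n =
     two_vertex (Omega 1) 0 (Omega n) n 0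
     - scale ((- 1) ^ (n - 2)) (\<Sum>p<n. two_vertex (Omega n) p (Omega 1) 1 (n - 1 - p))"

definition ainf_rhs :: "nat \<Rightarrow> (ainf_gen, 'k::field) lincomb" where
  "ainf_rhs n =
     (\<Sum>(p, q, r) \<in> {(p, q, r). q > 1 \<and> p + q + r = n \<and> p + 1 + r > 1}.
        scale ((- 1) ^ (p + q * r)) (two_vertex (Omega (p + 1 + r)) p (Omega q) q r))"

definition A_infinity_presentation :: "(ainf_gen, 'k::field) presentation" where
  "A_infinity_presentation =
    \<lparr> gens = {Omega n | n. n \<ge> 1},
      arity = (\<lambda>v. case v of Omega n \<Rightarrow> n),
      deg = (\<lambda>v. case v of Omega n \<Rightarrow> int n - 2),
      rels = (\<lambda>n. if n = 1 then {two_vertex (Omega 1) 0 (Omega 1) 1 0}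
                  else if n \<ge> 2 then {ainf_boundary n - ainf_rhs n}
                  else {}) \<rparr>"

datatype dend_gen = DOmega nat nat

definition dend_boundary :: "nat \<Rightarrow> nat \<Rightarrow> (dend_gen, 'k::field) lincomb" where
  "dend_boundary n i =
     two_vertex (DOmega 1 1) 0 (DOmega n i) n 0
     - scale ((- 1) ^ (n - 2)) (\<Sum>p<n. two_vertex (DOmega n i) p (DOmega 1 1) 1 (n - 1 - p))"

definition dend_index :: "nat \<Rightarrow> nat \<Rightarrow> (nat \<times> nat \<times> nat \<times> nat \<times> nat) set" where
  "dend_index n i =
     {(p, q, r, l, j). q \<ge> 2 \<and> p + q + r = n \<and> p + 1 + r \<ge> 2 \<and>
        1 \<le> l \<and> l \<le> p + 1 + r \<and> 1 \<le> j \<and> j \<le> q \<and>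
        (p + 1 \<le> l - 1 \<longrightarrow> i = q + l - 1) \<and>
        (p + 1 = l \<longrightarrow> i = l - 1 + j) \<and>
        (l + 1 \<le> p + 1 \<longrightarrow> i = l)}"

definition dend_rhs :: "nat \<Rightarrow> nat \<Rightarrow> (dend_gen, 'k::field) lincomb" where
  "dend_rhs n i =
     (\<Sum>(p, q, r, l, j) \<in> dend_index n i.
        scale ((- 1) ^ (p + q * r)) (two_vertex (DOmega (p + 1 + r) l) p (DOmega q j) q r))"

definition Dend_infinity_presentation :: "(dend_gen, 'k::field) presentation" where
  "Dend_infinity_presentation =
    \<lparr> gens = {DOmega n i | n i. n \<ge> 1 \<and> i \<in> {1..n}},
      arity = (\<lambda>v. case v of DOmega n i \<Rightarrow> n),
      deg = (\<lambda>v. case v of DOmega n i \<Rightarrow> int n - 2),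
      rels = (\<lambda>n. if n = 1 then {two_vertex (DOmega 1 1) 0 (DOmega 1 1) 1 0}
                  else if n \<ge> 2 then {dend_boundary n i - dend_rhs n i | i. i \<in> {1..n}}
                  else {}) \<rparr>"

definition Dend_infinity :: "('k, (dend_gen, 'k::field) lincomb set) ns_operad" where
  "Dend_infinity = presented_operad Dend_infinity_presentation"

end

theory Submission
  imports Defs
begin

text \<open>
  The assignment \<open>(Omega n, i) \<mapsto> DOmega n i\<close> is a bijection of all labels that respects
  arities and degrees, so relabelling vertices is an isomorphism of free operads.  It remains to see
  that it matches the relators.  Splitting a two-vertex tree \<open>a \<circ> (id\<^sup>p \<otimes> b \<otimes> id\<^sup>r)\<close>
  along leaf \<open>x\<close> fixes the index of \<open>b\<close> precisely if \<open>x\<close> is one of the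
  leaves above \<open>b\<close>; the three positions of \<open>x\<close> relative to these leaves are the three
  cases in the relations of \<open>Dend\<^sub>\<infinity>\<close>.
\<close>

section \<open>Linear extension\<close>

lemma lookup_scale [simp]: "Poly_Mapping.lookup (scale c p) t = c * Poly_Mapping.lookup p t"
  by (auto simp: scale_def Poly_Mapping.map.rep_eq when_def)

lemma lookup_mon: "Poly_Mapping.lookup (mon t) u = (1 when t = u)"
  by (simp add: mon_def lookup_single)

lemma keys_mon [simp]: "Poly_Mapping.keys (mon t :: ('v, 'k::field) lincomb) = {t}"
  by (simp add: mon_def)

lemma scale_zero_right [simp]: "scale c 0 = 0"
  by (rule poly_mapping_eqI) simp

lemma scale_zero_left [simp]: "scale 0 p = 0"
  by (rule poly_mapping_eqI) simp

lemma scale_one [simp]: "scale 1 p = p"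
  by (rule poly_mapping_eqI) simp

lemma scale_scale [simp]: "scale a (scale b p) = scale (a * b) p"
  by (rule poly_mapping_eqI) simp

lemma scale_add_right: "scale c (p + q) = scale c p + scale c q"
  by (rule poly_mapping_eqI) (simp add: lookup_add algebra_simps)

lemma scale_add_left: "scale (a + b) p = scale a p + scale b p"
  by (rule poly_mapping_eqI) (simp add: lookup_add algebra_simps)

lemma scale_sum: "scale c (sum f A) = (\<Sum>x\<in>A. scale c (f x))"
  by (induction A rule: infinite_finite_induct) (simp_all add: scale_add_right)

text \<open>Coefficients vanish outside the support. Enlarging the index set lets combinations with
  different supports be summed over one common set.\<close>

lemma lin_ext_superset:
  assumes "finite A" "Poly_Mapping.keys p \<subseteq> A"
  shows "lin_ext f p = (\<Sum>t\<in>A. scale (Poly_Mapping.lookup p t) (f t))"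
  unfolding lin_ext_def
  by (rule sum.mono_neutral_left[OF assms]) (simp add: in_keys_iff)

lemma lin_ext_mon [simp]: "lin_ext f (mon t) = f t"
  by (simp add: lin_ext_def lookup_mon)

lemma lin_ext_zero [simp]: "lin_ext f 0 = 0"
  by (simp add: lin_ext_def)

lemma lin_ext_add: "lin_ext f (p + q) = lin_ext f p + lin_ext f q"
proof -
  let ?A = "Poly_Mapping.keys p \<union> Poly_Mapping.keys q"
  \<comment> \<open>Cancellation can make this inclusion strict, so all three sums are taken over
    \<open>?A\<close>.\<close>
  have "Poly_Mapping.keys (p + q) \<subseteq> ?A"
    by (rule Poly_Mapping.keys_add)
  then show ?thesis
    by (simp add: lin_ext_superset[of ?A] lookup_add scale_add_left sum.distrib)
qed

lemma lin_ext_scale: "lin_ext f (scale c p) = scale c (lin_ext f p)"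
proof -
  have "Poly_Mapping.keys (scale c p) \<subseteq> Poly_Mapping.keys p"
    by (auto simp: in_keys_iff)
  then show ?thesis
    by (simp add: lin_ext_superset[of "Poly_Mapping.keys p"] scale_sum)
qed

lemma lin_ext_diff: "lin_ext f (p - q) = lin_ext f p - lin_ext f q"
  using lin_ext_add[of f "p - q" q] by (simp add: algebra_simps)

lemma lin_ext_sum: "lin_ext f (sum g A) = (\<Sum>x\<in>A. lin_ext f (g x))"
  by (induction A rule: infinite_finite_induct) (simp_all add: lin_ext_add)

lemma lin_ext_lin_ext: "lin_ext f (lin_ext g p) = lin_ext (\<lambda>t. lin_ext f (g t)) p"
  by (simp add: lin_ext_def[of g] lin_ext_def[of "\<lambda>t. lin_ext f (g t)"] lin_ext_sum lin_ext_scale)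

lemma lin_ext_mon_id [simp]: "lin_ext mon p = p"
proof (rule poly_mapping_eqI)
  fix u
  show "Poly_Mapping.lookup (lin_ext mon p) u = Poly_Mapping.lookup p u"
    by (simp add: lin_ext_def lookup_sum lookup_mon when_def in_keys_iff if_distrib cong: if_cong)
qed

lemma keys_lin_ext_subset:
  "Poly_Mapping.keys (lin_ext f p) \<subseteq> (\<Union>t\<in>Poly_Mapping.keys p. Poly_Mapping.keys (f t))"
proof -
  have "Poly_Mapping.keys (lin_ext f p) \<subseteq>
      (\<Union>t\<in>Poly_Mapping.keys p. Poly_Mapping.keys (scale (Poly_Mapping.lookup p t) (f t)))"
    unfolding lin_ext_def by (rule Poly_Mapping.keys_sum)
  also have "\<dots> \<subseteq> (\<Union>t\<in>Poly_Mapping.keys p. Poly_Mapping.keys (f t))"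
    by (auto simp: in_keys_iff)
  finally show ?thesis .
qed


section \<open>Relabelling of vertices\<close>

definition relabel :: "('v \<Rightarrow> 'w) \<Rightarrow> ('v, 'k::field) lincomb \<Rightarrow> ('w, 'k) lincomb" where
  "relabel f = lin_ext (\<lambda>t. mon (map_tree f t))"

lemma relabel_mon [simp]: "relabel f (mon t) = mon (map_tree f t)"
  by (simp add: relabel_def)

lemma relabel_zero [simp]: "relabel f 0 = 0"
  by (simp add: relabel_def)

lemma relabel_add: "relabel f (p + q) = relabel f p + relabel f q"
  by (simp add: relabel_def lin_ext_add)

lemma relabel_diff: "relabel f (p - q) = relabel f p - relabel f q"
  by (simp add: relabel_def lin_ext_diff)

lemma relabel_scale: "relabel f (scale c p) = scale c (relabel f p)"
  by (simp add: relabel_def lin_ext_scale)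

lemma relabel_sum: "relabel f (sum g A) = (\<Sum>x\<in>A. relabel f (g x))"
  by (simp add: relabel_def lin_ext_sum)

lemma relabel_inverse:
  assumes "\<And>v. g (f v) = v"
  shows "relabel g (relabel f p) = p"
proof -
  have "map_tree g (map_tree f t) = t" for t
    by (simp add: tree.map_comp o_def assms tree.map_ident)
  then show ?thesis
    by (simp add: relabel_def lin_ext_lin_ext)
qed

lemma keys_relabel_subset:
  "Poly_Mapping.keys (relabel f p) \<subseteq> map_tree f ` Poly_Mapping.keys p"
  using keys_lin_ext_subset[of "\<lambda>t. mon (map_tree f t)" p] by (auto simp: relabel_def)

lemma leaves_map_tree [simp]: "leaves (map_tree f t) = leaves t"
  by (induction t) (simp_all add: o_def cong: map_cong)

lemma tdeg_map_tree [simp]: "tdeg d (map_tree f t) = tdeg (d \<circ> f) t"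
  by (induction t) (simp_all add: o_def cong: map_cong)

lemma map_tree_graft_at:
  "map_tree f (graft_at i s u) = graft_at i (map_tree f s) (map_tree f u)"
  "map (map_tree f) (graft_at_list i ts u) = graft_at_list i (map (map_tree f) ts) (map_tree f u)"
  by (induction i s u and i ts u rule: graft_at_graft_at_list.induct) simp_all

lemma deg_after_map_tree [simp]:
  "deg_after d i (map_tree f s) = deg_after (d \<circ> f) i s"
  "deg_after_list d i (map (map_tree f) ts) = deg_after_list (d \<circ> f) i ts"
  by (induction "d \<circ> f" i s and "d \<circ> f" i ts rule: deg_after_deg_after_list.induct)
    (simp_all add: o_def)

lemma relabel_tree_comp:
  "relabel f (tree_comp (d \<circ> f) i s t) = tree_comp d i (map_tree f s) (map_tree f t)"
  by (simp add: tree_comp_def relabel_scale map_tree_graft_at)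

text \<open>Both sides are bilinear, so monomials suffice. There the Koszul sign depends only on
  degrees and leaf positions, which relabelling keeps once \<open>d\<close> is pulled back along
  \<open>f\<close>.\<close>

lemma relabel_free_comp:
  "relabel f (free_comp (d \<circ> f) i p q) = free_comp d i (relabel f p) (relabel f q)"
  by (simp add: free_comp_def relabel_def lin_ext_lin_ext
        relabel_tree_comp[unfolded relabel_def])

section \<open>Morphisms and isomorphisms of presentations\<close>

locale presentation_hom =
  fixes P :: "('v, 'k::field) presentation" and Q :: "('w, 'k) presentation" and f :: "'v \<Rightarrow> 'w"
  assumes gens: "v \<in> gens P \<Longrightarrow> f v \<in> gens Q"
    and arity: "arity Q (f v) = arity P v"
    and deg: "deg Q (f v) = deg P v"
    and rels: "r \<in> rels P n \<Longrightarrow> relabel f r \<in> rels Q n"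
begin

lemma deg_comp: "deg Q \<circ> f = deg P"
  by (simp add: fun_eq_iff deg)

lemma wf_map_tree: "wf_tree P t \<Longrightarrow> wf_tree Q (map_tree f t)"
  by (induction t) (auto simp: gens arity)

lemma relabel_free_space: "p \<in> free_space P n \<Longrightarrow> relabel f p \<in> free_space Q n"
  using keys_relabel_subset[of f p] by (fastforce simp: free_space_def wf_map_tree)

lemma relabel_free_homog: "p \<in> free_homog P n e \<Longrightarrow> relabel f p \<in> free_homog Q n e"
  using keys_relabel_subset[of f p] relabel_free_space[of p n]
  by (fastforce simp: free_homog_def deg_comp)

text \<open>Degrees are matched on all labels, not only on generators, so this holds for arbitrary
  \<open>p\<close> and \<open>q\<close>. The induction over the ideal relies on that: its elements
  are not first shown to lie in \<open>free_space\<close>.\<close>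

lemma relabel_comp:
  "relabel f (free_comp (deg P) i p q) = free_comp (deg Q) i (relabel f p) (relabel f q)"
  using relabel_free_comp[of f "deg Q"] by (simp add: deg_comp)

lemma relabel_ideal_pairs:
  "(n, p) \<in> ideal_pairs P \<Longrightarrow> (n, relabel f p) \<in> ideal_pairs Q"
proof (induction n p rule: ideal_pairs.induct)
  case comp_left
  then show ?case
    unfolding relabel_comp by (blast intro: ideal_pairs.comp_left relabel_free_space)
next
  case comp_right
  then show ?case
    unfolding relabel_comp by (blast intro: ideal_pairs.comp_right relabel_free_space)
qed (auto simp: relabel_add relabel_scale rels intro: ideal_pairs.intros)

lemma relabel_ideal: "p \<in> ideal P n \<Longrightarrow> relabel f p \<in> ideal Q n"
  by (simp add: ideal_def relabel_ideal_pairs)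

lemma map_corolla: "map_tree f (corolla P v) = corolla Q (f v)"
  by (simp add: corolla_def arity)

end

locale presentation_iso =
  fwd: presentation_hom P Q f + bwd: presentation_hom Q P g
  for P :: "('v, 'k::field) presentation" and Q :: "('w, 'k) presentation"
    and f :: "'v \<Rightarrow> 'w" and g :: "'w \<Rightarrow> 'v" +
  assumes left_inverse: "g (f v) = v" and right_inverse: "f (g w) = w"
begin

lemma relabel_inverses [simp]: "relabel g (relabel f p) = p" "relabel f (relabel g q) = q"
  by (simp_all add: relabel_inverse left_inverse right_inverse)

lemma inj_relabel: "inj (relabel f :: ('v, 'k) lincomb \<Rightarrow> _)"
  by (rule inj_on_inverseI[of _ "relabel g"]) simp

text \<open>The inverse relabelling turns surjectivity onto \<open>B\<close> into a second
  inclusion, so the equalities of images below follow from the two homomorphisms.\<close>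

lemma image_relabel_eqI:
  assumes "\<And>p. p \<in> A \<Longrightarrow> relabel f p \<in> B" "\<And>q. q \<in> B \<Longrightarrow> relabel g q \<in> A"
  shows "relabel f ` A = B"
proof
  show "B \<subseteq> relabel f ` A"
    using assms(2) by (metis image_eqI relabel_inverses(2) subsetI)
qed (use assms(1) in auto)

lemma image_relabel_free_space: "relabel f ` free_space P n = free_space Q n"
  by (rule image_relabel_eqI) (rule fwd.relabel_free_space bwd.relabel_free_space, assumption)+

lemma image_relabel_free_homog: "relabel f ` free_homog P n e = free_homog Q n e"
  by (rule image_relabel_eqI) (rule fwd.relabel_free_homog bwd.relabel_free_homog, assumption)+

lemma image_relabel_ideal: "relabel f ` ideal P n = ideal Q n"
  by (rule image_relabel_eqI) (rule fwd.relabel_ideal bwd.relabel_ideal, assumption)+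

text \<open>By additivity the image is a translate of the image of the ideal. Equality of the ideals
  matters: under a mere inclusion the image could be a proper part of a coset.\<close>

lemma image_relabel_coset: "relabel f ` coset P n p = coset Q n (relabel f p)"
  by (auto simp: coset_def image_def relabel_add simp flip: image_relabel_ideal)

lemma image_relabel_gen_class: "relabel f ` gen_class P v = gen_class Q (f v)"
  by (simp add: gen_class_def image_relabel_coset fwd.map_corolla fwd.arity)

lemma image_image_coset:
  "image (relabel f) ` (coset P n ` A) = coset Q n ` (relabel f ` A)"
  by (simp add: image_image image_relabel_coset)

text \<open>The map acts on cosets by direct image, so no representatives are chosen and
  well-definedness is automatic.\<close>

theorem operad_iso_presented:
  "operad_iso (presented_operad P) (presented_operad Q) (\<lambda>n. image (relabel f))"
proof -
  have "bij_betw (image (relabel f)) (coset P n ` free_space P n) (coset Q n ` free_space Q n)" for n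
    by (simp add: bij_betw_def image_image_coset image_relabel_free_space
        inj_on_def inj_image_eq_iff[OF inj_relabel])
  \<comment> \<open>Addition, scaling and composition of cosets are unions over all representatives.
    Direct image commutes with unions, which leaves the corresponding identities for
    \<open>relabel f\<close>.\<close>
  then show ?thesis
    by (simp add: operad_iso_def presented_operad_def image_image_coset image_relabel_free_homog
        image_UN image_relabel_coset relabel_add relabel_scale fwd.relabel_comp)
qed

end


section \<open>Splitting trees with two vertices\<close>

lemma listset_singletons: "listset (map (\<lambda>t. {t}) ts) = {ts}"
  by (induction ts) (auto simp: set_Cons_def)

lemma listset_slot:
  "listset (map (\<lambda>t. {t}) us @ A # map (\<lambda>t. {t}) ws) = (\<lambda>t. us @ t # ws) ` A"
  by (induction us) (auto simp: set_Cons_def listset_singletons)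

lemma prod_list_lookup_mon:
  "prod_list (map2 Poly_Mapping.lookup (map mon ts) ts) = (1 :: 'k::field)"
  by (induction ts) (simp_all add: lookup_mon)

text \<open>With monomials in all other slots the expansion runs over the support of
  \<open>p\<close> alone, and the other coefficients contribute the factor 1. The root of a
  two-vertex tree is of this form.\<close>

lemma mnode_slot:
  "mnode v (map mon us @ p # map mon ws) = lin_ext (\<lambda>t. mon (Node v (us @ t # ws))) p"
proof -
  have "listset (map Poly_Mapping.keys (map mon us @ p # map mon ws)) =
      (\<lambda>t. us @ t # ws) ` Poly_Mapping.keys p"
    by (simp add: o_def listset_slot)
  moreover have "inj_on (\<lambda>t. us @ t # ws) A" for A
    by (simp add: inj_on_def)
  ultimately show ?thesis
    by (simp add: mnode_def lin_ext_def sum.reindex prod_list_lookup_mon)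
qed

lemma mnode_mon: "mnode v (map mon ts) = mon (Node v ts)"
  by (simp add: mnode_def o_def listset_singletons prod_list_lookup_mon)

lemma mnode_leaves: "mnode v (replicate q (mon Leaf)) = mon (Node v (replicate q Leaf))"
  using mnode_mon[of v "replicate q Leaf"] by simp

lemma mnode_slot_leaves:
  "mnode v (replicate p (mon Leaf) @ c # replicate r (mon Leaf)) =
    lin_ext (\<lambda>t. mon (Node v (replicate p Leaf @ t # replicate r Leaf))) c"
  using mnode_slot[of v "replicate p Leaf" c "replicate r Leaf"] by simp

lemma leaves_corolla [simp]: "leaves (Node b (replicate q Leaf)) = q"
  by (simp add: sum_list_replicate)

lemma branch_replicate:
  "1 \<le> x \<Longrightarrow> branch x (replicate p Leaf @ ts) = (if x \<le> p then x else p + branch (x - p) ts)"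
  by (induction p arbitrary: x) auto

lemma branch_leaves: "1 \<le> x \<Longrightarrow> x \<le> q \<Longrightarrow> branch x (replicate q Leaf) = x"
  using branch_replicate[of x q "[]"] by simp

lemma ASp_leaf_list_leaves: "ASp_leaf_list ar x (replicate q Leaf) = replicate q (mon Leaf)"
  by (induction q arbitrary: x) auto

text \<open>Left and right of \<open>t\<close> are one case, since \<open>t\<close> is then split
  without a marked leaf. Numbering from 1 matters: for \<open>x = 0\<close> the recursion would
  enter the first tree.\<close>

lemma ASp_leaf_list_slot:
  assumes "1 \<le> x"
  shows "ASp_leaf_list ar x (replicate p Leaf @ t # replicate r Leaf) =
    replicate p (mon Leaf) @
    (if p < x \<and> x \<le> p + leaves t then ASp_leaf ar (x - p) t else ASp_tree ar t) #
    replicate r (mon Leaf)"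
  using assms by (induction p arbitrary: x) (auto simp: ASp_leaf_list_leaves)

lemma ASp_leaf_corolla:
  "1 \<le> x \<Longrightarrow> x \<le> q \<Longrightarrow>
    ASp_leaf ar x (Node b (replicate q Leaf)) = mon (Node (b, x) (replicate q Leaf))"
  by (simp add: branch_leaves ASp_leaf_list_leaves mnode_leaves)

lemma ASp_tree_corolla:
  "ar b = q \<Longrightarrow>
    ASp_tree ar (Node b (replicate q Leaf)) = (\<Sum>j\<in>{1..q}. mon (Node (b, j) (replicate q Leaf)))"
  by (simp add: mnode_leaves)

text \<open>The root is indexed by the branch containing \<open>x\<close>. To the right of
  \<open>b\<close> its \<open>q\<close> leaves count as one branch, whence \<open>x - q + 1\<close>;
  the subtraction does not truncate because \<open>p + q < x\<close> there.\<close>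

lemma ASp_two_vertex:
  assumes "ar b = q" "1 \<le> x" "x \<le> p + q + r"
  shows "lin_ext (ASp_leaf ar x) (two_vertex a p b q r) =
    (if x \<le> p then \<Sum>j\<in>{1..q}. two_vertex (a, x) p (b, j) q r :: (_, 'k::field) lincomb
     else if x \<le> p + q then two_vertex (a, p + 1) p (b, x - p) q r
     else \<Sum>j\<in>{1..q}. two_vertex (a, x - q + 1) p (b, j) q r)"
proof -
  let ?u = "Node b (replicate q Leaf)"
  have branch: "branch x (replicate p Leaf @ ?u # replicate r Leaf) =
      (if x \<le> p then x else if x \<le> p + q then p + 1 else x - q + 1)"
    using assms by (auto simp: branch_replicate branch_leaves sum_list_replicate)
  have "lin_ext (ASp_leaf ar x) (two_vertex a p b q r) =
      (mnode (a, branch x (replicate p Leaf @ ?u # replicate r Leaf))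
        (ASp_leaf_list ar x (replicate p Leaf @ ?u # replicate r Leaf)) :: (_, 'k) lincomb)"
    by (simp add: two_vertex_def)
  also have "ASp_leaf_list ar x (replicate p Leaf @ ?u # replicate r Leaf) =
      replicate p (mon Leaf) @
      (if p < x \<and> x \<le> p + q then ASp_leaf ar (x - p) ?u else ASp_tree ar ?u) #
      replicate r (mon Leaf)"
    by (simp only: ASp_leaf_list_slot[OF \<open>1 \<le> x\<close>] leaves_corolla)
  finally have "lin_ext (ASp_leaf ar x) (two_vertex a p b q r) =
      (mnode (a, branch x (replicate p Leaf @ ?u # replicate r Leaf))
        (replicate p (mon Leaf) @
         (if p < x \<and> x \<le> p + q then ASp_leaf ar (x - p) ?u else ASp_tree ar ?u) #
         replicate r (mon Leaf)) :: (_, 'k) lincomb)" .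
  moreover have "p < x \<Longrightarrow> x \<le> p + q \<Longrightarrow>
      ASp_leaf ar (x - p) ?u = (mon (Node (b, x - p) (replicate q Leaf)) :: (_, 'k) lincomb)"
    by (rule ASp_leaf_corolla) auto
  ultimately show ?thesis
    using assms(1)
    by (auto simp: branch mnode_slot_leaves ASp_tree_corolla lin_ext_sum two_vertex_def
        simp del: ASp_tree.simps ASp_leaf.simps)
qed

lemma relabel_two_vertex [simp]:
  "relabel f (two_vertex a p b q r) = two_vertex (f a) p (f b) q r"
  by (simp add: two_vertex_def)


section \<open>The relators\<close>

abbreviation ainf_arity :: "ainf_gen \<Rightarrow> nat" where
  "ainf_arity \<equiv> \<lambda>v. case v of Omega n \<Rightarrow> n"

fun dend_of_pair :: "ainf_gen \<times> nat \<Rightarrow> dend_gen" where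
  "dend_of_pair (Omega n, i) = DOmega n i"

fun pair_of_dend :: "dend_gen \<Rightarrow> ainf_gen \<times> nat" where
  "pair_of_dend (DOmega n i) = (Omega n, i)"

lemma pair_of_dend_of_pair: "pair_of_dend (dend_of_pair v) = v"
  by (cases v rule: dend_of_pair.cases) simp

lemma dend_of_pair_of_dend: "dend_of_pair (pair_of_dend w) = w"
  by (cases w) simp

text \<open>Each composite involves \<open>Omega 1\<close>, whose only index is 1. If it sits on
  \<open>Omega n\<close>, then \<open>q = 1\<close> gives the root index \<open>x\<close> in all
  three cases; if it is the root, every leaf lies above \<open>Omega n\<close>, which receives the
  index \<open>x\<close>.\<close>

lemma ASp_boundary:
  assumes "x \<in> {1..n}"
  shows "relabel dend_of_pair (lin_ext (ASp_leaf ainf_arity x) (ainf_boundary n)) =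
    (dend_boundary n x :: (_, 'k::field) lincomb)"
proof -
  have "relabel dend_of_pair
      (lin_ext (ASp_leaf ainf_arity x) (two_vertex (Omega n) p (Omega 1) 1 (n - 1 - p))) =
      (two_vertex (DOmega n x) p (DOmega 1 1) 1 (n - 1 - p) :: (_, 'k) lincomb)" if "p < n" for p
    using assms that by (subst ASp_two_vertex) (auto simp: le_Suc_eq)
  moreover have "relabel dend_of_pair
      (lin_ext (ASp_leaf ainf_arity x) (two_vertex (Omega 1) 0 (Omega n) n 0)) =
      (two_vertex (DOmega 1 1) 0 (DOmega n x) n 0 :: (_, 'k) lincomb)"
    using assms by (subst ASp_two_vertex) auto
  ultimately show ?thesis
    by (simp add: ainf_boundary_def dend_boundary_def lin_ext_diff lin_ext_scale lin_ext_sum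
        relabel_diff relabel_scale relabel_sum)
qed

text \<open>The fibre of \<open>dend_index\<close> over an admissible triple
  \<open>(p, q, r)\<close>: it groups the sum in \<open>dend_rhs\<close> by the composite of
  generators of A-infinity that is being split.\<close>

definition split_index :: "nat \<Rightarrow> nat \<times> nat \<times> nat \<Rightarrow> (nat \<times> nat) set" where
  "split_index i = (\<lambda>(p, q, r).
     {(l, j). 1 \<le> l \<and> l \<le> p + 1 + r \<and> 1 \<le> j \<and> j \<le> q \<and>
        (p + 1 \<le> l - 1 \<longrightarrow> i = q + l - 1) \<and>
        (p + 1 = l \<longrightarrow> i = l - 1 + j) \<and>
        (l + 1 \<le> p + 1 \<longrightarrow> i = l)})"

text \<open>The conditions for \<open>l < p + 1\<close>, \<open>l = p + 1\<close> and
  \<open>l > p + 1\<close> put \<open>i\<close> in \<open>{1..p}\<close>, in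
  \<open>{p+1..p+q}\<close> and above \<open>p + q\<close> respectively, so \<open>i\<close>
  determines which one applies and hence \<open>l\<close>.\<close>

lemma split_index_eq:
  assumes "1 \<le> i" "i \<le> p + q + r"
  shows "split_index i (p, q, r) =
    (if i \<le> p then {i} \<times> {1..q}
     else if i \<le> p + q then {(p + 1, i - p)}
     else {i - q + 1} \<times> {1..q})"
  using assms by (auto simp: split_index_def)

lemma ASp_two_vertex_split:
  assumes "1 \<le> x" "x \<le> p + q + r"
  shows "relabel dend_of_pair
      (lin_ext (ASp_leaf ainf_arity x) (two_vertex (Omega k) p (Omega q) q r)) =
    (\<Sum>(l, j)\<in>split_index x (p, q, r). two_vertex (DOmega k l) p (DOmega q j) q r)"
  using assms
  by (subst ASp_two_vertex)
    (auto simp: split_index_eq relabel_sum simp flip: sum.cartesian_product)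

lemma ASp_rhs:
  assumes "x \<in> {1..n}"
  shows "relabel dend_of_pair (lin_ext (ASp_leaf ainf_arity x) (ainf_rhs n)) =
    (dend_rhs n x :: (_, 'k::field) lincomb)"
proof -
  \<comment> \<open>\<open>M\<close> indexes the composites in \<open>ainf_rhs\<close>;
    \<open>F\<close> is the summand of \<open>dend_rhs\<close> with its five indices bracketed as a
    composite and a choice of labels.\<close>
  define M where "M = {(p, q, r). q > 1 \<and> p + q + r = n \<and> p + 1 + r > (1 :: nat)}"
  define F where "F = (\<lambda>((p, q, r), (l, j)).
    scale ((- 1) ^ (p + q * r)) (two_vertex (DOmega (p + 1 + r) l) p (DOmega q j) q r) :: (_, 'k) lincomb)"
  have "finite M"
    by (rule finite_subset[of _ "{..n} \<times> {..n} \<times> {..n}"]) (auto simp: M_def)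
  have "finite (split_index x m)" for m
    by (cases m, rule finite_subset[of _ "{..fst m + 1 + snd (snd m)} \<times> {..fst (snd m)}"])
      (auto simp: split_index_def)
  have "relabel dend_of_pair (lin_ext (ASp_leaf ainf_arity x) (ainf_rhs n)) =
      (\<Sum>m\<in>M. \<Sum>s\<in>split_index x m. F (m, s))"
    unfolding ainf_rhs_def M_def[symmetric] lin_ext_sum relabel_sum
  proof (rule sum.cong[OF refl])
    fix m assume "m \<in> M"
    then obtain p q r where m: "m = (p, q, r)" "p + q + r = n"
      by (auto simp: M_def)
    then have "1 \<le> x" "x \<le> p + q + r"
      using assms by auto
    then show "relabel dend_of_pair (lin_ext (ASp_leaf ainf_arity x) (case m of (p, q, r) \<Rightarrow>
        scale ((- 1) ^ (p + q * r)) (two_vertex (Omega (p + 1 + r)) p (Omega q) q r))) =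
        (\<Sum>s\<in>split_index x m. F (m, s))"
      by (simp add: m lin_ext_scale relabel_scale scale_sum F_def case_prod_unfold
          ASp_two_vertex_split)
  qed
  also have "\<dots> = (\<Sum>z\<in>Sigma M (split_index x). F z)"
    using \<open>finite M\<close> \<open>\<And>m. finite (split_index x m)\<close> by (simp add: sum.Sigma)
  \<comment> \<open>Only the bracketing of the indices changes; \<open>q > 1\<close> and
    \<open>q \<ge> 2\<close> are the same condition.\<close>
  also have "\<dots> = dend_rhs n x"
    unfolding dend_rhs_def
    by (rule sum.reindex_bij_witness[of _ "\<lambda>(p, q, r, l, j). ((p, q, r), (l, j))"
          "\<lambda>((p, q, r), (l, j)). (p, q, r, l, j)"])
      (auto simp: M_def split_index_def dend_index_def F_def)
  finally show ?thesis .
qed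

lemma ASp_relator:
  "x \<in> {1..n} \<Longrightarrow>
    relabel dend_of_pair (lin_ext (ASp_leaf ainf_arity x) (ainf_boundary n - ainf_rhs n)) =
    dend_boundary n x - dend_rhs n x"
  by (simp add: lin_ext_diff relabel_diff ASp_boundary ASp_rhs)

lemma ASp_relator_one:
  "relabel dend_of_pair (lin_ext (ASp_leaf ainf_arity 1) (two_vertex (Omega 1) 0 (Omega 1) 1 0)) =
    two_vertex (DOmega 1 1) 0 (DOmega 1 1) 1 0"
  by (subst ASp_two_vertex) auto

text \<open>For \<open>n \<ge> 2\<close> the single relator, split along its \<open>n\<close>
  leaves, yields the \<open>n\<close> relators of the other side. Equality of the sets, rather than
  an inclusion, serves both directions of the isomorphism.\<close>

lemma rels_Dend_infinity:
  "rels Dend_infinity_presentation n =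
    relabel dend_of_pair ` rels (ASp_presentation A_infinity_presentation) n"
proof -
  let ?R = "rels A_infinity_presentation n :: (ainf_gen, 'a) lincomb set"
  have "relabel dend_of_pair ` rels (ASp_presentation A_infinity_presentation) n =
      {relabel dend_of_pair (lin_ext (ASp_leaf ainf_arity x) r) | x r. x \<in> {1..n} \<and> r \<in> ?R}"
    by (auto simp: ASp_presentation_def A_infinity_presentation_def)
  also have "\<dots> = rels Dend_infinity_presentation n"
  proof -
    consider "n = 0" | "n = 1" | "n \<ge> 2" by linarith
    then show ?thesis
    proof cases
      case 2
      then show ?thesis
        using ASp_relator_one
        by (auto simp: A_infinity_presentation_def Dend_infinity_presentation_def)
    next
      case 3
      then have "?R = {ainf_boundary n - ainf_rhs n}"
        by (simp add: A_infinity_presentation_def)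
      then have "{relabel dend_of_pair (lin_ext (ASp_leaf ainf_arity x) r) | x r.
            x \<in> {1..n} \<and> r \<in> ?R} =
          (\<lambda>x. relabel dend_of_pair
            (lin_ext (ASp_leaf ainf_arity x) (ainf_boundary n - ainf_rhs n))) ` {1..n}"
        by auto
      also have "\<dots> = (\<lambda>x. dend_boundary n x - dend_rhs n x) ` {1..n}"
        by (rule image_cong[OF refl ASp_relator])
      finally show ?thesis
        using 3 by (auto simp: Dend_infinity_presentation_def)
    qed (simp add: A_infinity_presentation_def Dend_infinity_presentation_def)
  qed
  finally show ?thesis by simp
qed

section \<open>The isomorphism of operads\<close>

lemma presentation_iso_Dend_infinity:
  "presentation_iso (ASp_presentation A_infinity_presentation :: (_, 'k::field) presentation)
    Dend_infinity_presentation dend_of_pair pair_of_dend"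
proof
  let ?A = "ASp_presentation A_infinity_presentation :: (_, 'k) presentation"
  let ?D = "Dend_infinity_presentation :: (_, 'k) presentation"
  show "dend_of_pair v \<in> gens ?D" if "v \<in> gens ?A" for v
    using that
    by (auto simp: ASp_presentation_def A_infinity_presentation_def Dend_infinity_presentation_def)
  show "pair_of_dend w \<in> gens ?A" if "w \<in> gens ?D" for w
    using that
    by (auto simp: ASp_presentation_def A_infinity_presentation_def Dend_infinity_presentation_def)
  show arity: "arity ?D (dend_of_pair v) = arity ?A v" for v
    by (cases v rule: dend_of_pair.cases)
      (simp add: ASp_presentation_def A_infinity_presentation_def Dend_infinity_presentation_def)
  show deg: "deg ?D (dend_of_pair v) = deg ?A v" for v
    by (cases v rule: dend_of_pair.cases)
      (simp add: ASp_presentation_def A_infinity_presentation_def Dend_infinity_presentation_def)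
  \<comment> \<open>Every \<open>w\<close> is \<open>dend_of_pair (pair_of_dend w)\<close>, so the
    inverse inherits arities and degrees from the forward direction.\<close>
  show "arity ?A (pair_of_dend w) = arity ?D w" for w
    using arity[of "pair_of_dend w"] by (simp add: dend_of_pair_of_dend)
  show "deg ?A (pair_of_dend w) = deg ?D w" for w
    using deg[of "pair_of_dend w"] by (simp add: dend_of_pair_of_dend)
  show "relabel dend_of_pair r \<in> rels ?D n" if "r \<in> rels ?A n" for r n
    using that by (simp add: rels_Dend_infinity)
  \<comment> \<open>Here \<open>r\<close> is the relabelling of a relator of \<open>?A\<close>,
    which the inverse relabelling recovers.\<close>
  show "relabel pair_of_dend r \<in> rels ?A n" if "r \<in> rels ?D n" for r n
    using that by (auto simp: rels_Dend_infinity relabel_inverse pair_of_dend_of_pair)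
qed (rule pair_of_dend_of_pair dend_of_pair_of_dend)+

theorem proposition3p3:
  shows "\<exists>\<Phi>. operad_iso (ASp (A_infinity_presentation :: (ainf_gen, 'k::field) presentation))
                 (Dend_infinity :: ('k, (dend_gen, 'k) lincomb set) ns_operad) \<Phi> \<and>
              (\<forall>n\<ge>1. \<forall>i\<in>{1..n}.
                 \<Phi> n (gen_class (ASp_presentation A_infinity_presentation) (Omega n, i))
                 = gen_class Dend_infinity_presentation (DOmega n i))"
proof -
  interpret presentation_iso
    "ASp_presentation A_infinity_presentation :: (_, 'k) presentation"
    Dend_infinity_presentation dend_of_pair pair_of_dend
    by (rule presentation_iso_Dend_infinity)
  \<comment> \<open>The witness is direct image under \<open>relabel dend_of_pair\<close>; it takes
    the class of a corolla to that of the relabelled corolla, which gives the required values on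
    generators.\<close>
  show ?thesis
    unfolding ASp_def Dend_infinity_def
    using operad_iso_presented image_relabel_gen_class by (metis dend_of_pair.simps)
qed

end
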